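(* Let $a,b\in\mathbb{R}\cup\{-\infty,+\infty\}$ with $a<b$, and let $\Lambda\subseteq\mathbb{R}$ be a subset of $(a,b]$ that is dense in $(a,b]$ in the Euclidean topology. The following are equivalent: (i) $\Lambda$ is countable; (ii) $(a,b]_\Lambda$ is second-countable; (iii) $(a,b]_\Lambda$ is metrizable; (iv) $(a,b]_\Lambda$ is an ultrametric space (i.e., its topology is induced by an ultrametric distance).
   Context: For $a<b$ in $\mathbb{R}\cup\{-\infty,+\infty\}$ and $\Lambda\subseteq\mathbb{R}$, $(a,b]_\Lambda$ denotes the interval $(a,b]$ endowed with the $\Lambda$-upper limit topology, i.e., the topology generated by the sets $(\alpha,\lambda]\cap(a,b]$, for $\lambda\in\Lambda\cup\{\infty\}$ and $\alpha\in(a,b]$ (together with the whole space). In particular each $(\alpha,b]$ is open. If $b=+\infty$, the point $+\infty$ belongs to $(a,b]$. *)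

theory Defs
  imports "HOL-Analysis.Analysis"
begin

text \<open>
  Points of \<open>(a,b]\<close> are extended reals, so that \<open>+\<infinity>\<close> is a point of the space when
  \<open>b = +\<infinity>\<close>. For \<open>\<lambda> = +\<infinity>\<close> the generating set is \<open>(\<alpha>,b]\<close>.
\<close>

definition upper_limit_topology :: "ereal \<Rightarrow> ereal \<Rightarrow> real set \<Rightarrow> ereal topology" where
  "upper_limit_topology a b \<Lambda> =
     topology_generated_by
       (insert {a<..b}
         {{\<alpha><..l} \<inter> {a<..b} | \<alpha> l. \<alpha> \<in> {a<..b} \<and> l \<in> insert \<infinity> (ereal ` \<Lambda>)})"

definition ultrametrizable_space :: "'a topology \<Rightarrow> bool" where
  "ultrametrizable_space X \<longleftrightarrow>
     (\<exists>M d. Metric_space M d \<and>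
            (\<forall>x\<in>M. \<forall>y\<in>M. \<forall>z\<in>M. d x z \<le> max (d x y) (d y z)) \<and>
            X = Metric_space.mtopology M d)"

end

theory Submission
  imports Defs
begin

text \<open>
  The sets \<open>(a,\<lambda>]\<close> with \<open>\<lambda> \<in> \<Lambda>\<close> are clopen, they separate points because \<open>\<Lambda>\<close> is dense, and
  together with their complements they generate the topology. If \<open>\<Lambda>\<close> is countable, enumerate
  them as \<open>B\<^sub>0, B\<^sub>1, \<dots>\<close>; the distance \<open>1 / (n + 1)\<close>, where \<open>n\<close> is the first index such that
  \<open>B\<^sub>n\<close> separates the two points, is an ultrametric inducing the topology. Conversely, the
  rationals are dense in the space, so that metrizability gives a countable base; and for each
  \<open>\<lambda> \<in> \<Lambda>\<close> every base contains a set with greatest element \<open>\<lambda>\<close>, so that \<open>\<Lambda>\<close> injects into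
  the base.
\<close>

section \<open>General facts on metrizable spaces\<close>

lemma ultrametrizable_imp_metrizable_space:
  "ultrametrizable_space X \<Longrightarrow> metrizable_space X"
  by (auto simp: ultrametrizable_space_def metrizable_space_def)

text \<open>The balls of radius \<open>1 / Suc n\<close> around the points of a countable dense set
  form a countable base.\<close>

lemma metrizable_separable_imp_second_countable:
  assumes "metrizable_space X" "separable_space X"
  shows "second_countable X"
proof -
  obtain M d where "Metric_space M d" and X: "X = Metric_space.mtopology M d"
    using assms(1) by (auto simp: metrizable_space_def)
  then interpret Metric_space M d by simp
  obtain D where "countable D" and D: "D \<subseteq> M" "mtopology closure_of D = M"
    using assms(2) by (auto simp: separable_space_def X)
  define \<B> where "\<B> = (\<lambda>(x, n). mball x (1 / real (Suc n))) ` (D \<times> UNIV)"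
  have "countable \<B>"
    unfolding \<B>_def using \<open>countable D\<close> by simp
  moreover have "\<exists>V\<in>\<B>. x \<in> V \<and> V \<subseteq> U" if U: "openin mtopology U" "x \<in> U" for U x
  proof -
    obtain r where r: "r > 0" "mball x r \<subseteq> U" and x: "x \<in> M"
      using U unfolding openin_mtopology by blast
    \<comment> \<open>Half of \<open>r\<close> leaves room for two steps: from \<open>x\<close> to
      the centre \<open>y\<close>, and from \<open>y\<close> to any point of its ball.\<close>
    obtain n where n: "1 / real (Suc n) < r / 2"
      using nat_approx_posE[of "r / 2"] r(1) by auto
    have "x \<in> mtopology closure_of D" using D(2) x by simp
    then have "\<exists>y\<in>D. y \<in> mball x (1 / real (Suc n))"
      unfolding metric_closure_of mem_Collect_eq by (elim conjE allE[of _ "1 / real (Suc n)"]) simp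
    then obtain y where y: "y \<in> D" "y \<in> mball x (1 / real (Suc n))" by blast
    have "mball y (1 / real (Suc n)) \<subseteq> mball x r"
      using y(2) n by (intro mball_subset) (auto simp: commute)
    moreover have "x \<in> mball y (1 / real (Suc n))"
      using y(2) by (auto simp: commute)
    ultimately show ?thesis
      using y(1) r(2) unfolding \<B>_def by blast
  qed
  ultimately show ?thesis
    unfolding second_countable_def X by (intro exI[of _ \<B>]) (auto simp: \<B>_def)
qed

section \<open>An ultrametric from a sequence of clopen sets\<close>

lemma less_Least_iff:
  fixes P :: "nat \<Rightarrow> bool"
  assumes "\<exists>n. P n"
  shows "N < (LEAST n. P n) \<longleftrightarrow> (\<forall>n\<le>N. \<not> P n)"
proof
  show "\<forall>n\<le>N. \<not> P n" if "N < (LEAST n. P n)"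
    using that not_less_Least[of _ P] by (meson le_less_trans)
  show "N < (LEAST n. P n)" if "\<forall>n\<le>N. \<not> P n"
    using that LeastI_ex[OF assms] by (metis not_less)
qed

text \<open>Sending \<open>x\<close> to the 0-1 sequence of its memberships in the sets
  \<open>B n\<close> embeds the space in the Cantor space: injectivity is \<open>separating\<close>,
  continuity is \<open>clopen\<close>, and openness onto the image is \<open>generating\<close>. The
  ultrametric is the one pulled back along this map.\<close>

lemma ultrametrizable_space_clopen_sequence:
  fixes B :: "nat \<Rightarrow> 'a set"
  assumes clopen: "\<And>n. openin X (B n)" "\<And>n. closedin X (B n)"
    and separating: "\<And>x y. \<lbrakk>x \<in> topspace X; y \<in> topspace X; x \<noteq> y\<rbrakk> \<Longrightarrow> \<exists>n. (x \<in> B n) \<noteq> (y \<in> B n)"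
    and generating: "\<And>U x. \<lbrakk>openin X U; x \<in> U\<rbrakk> \<Longrightarrow>
      \<exists>N. {y \<in> topspace X. \<forall>n\<le>N. x \<in> B n \<longleftrightarrow> y \<in> B n} \<subseteq> U"
  shows "ultrametrizable_space X"
proof -
  let ?M = "topspace X"
  define L where "L x y = (LEAST n. (x \<in> B n) \<noteq> (y \<in> B n))" for x y
  \<comment> \<open>Equal points are treated apart, since no index separates them and
    \<open>L x x\<close> is then an unspecified number.\<close>
  define d where "d x y = (if x = y then 0 else 1 / real (Suc (L x y)))" for x y
  have L_commute: "L x y = L y x" for x y
    unfolding L_def by (rule arg_cong[where f = Least]) auto
  have d_less: "d x y < 1 / real (Suc N) \<longleftrightarrow> (\<forall>n\<le>N. x \<in> B n \<longleftrightarrow> y \<in> B n)"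
    if "x \<in> ?M" "y \<in> ?M" for x y N
  proof (cases "x = y")
    case False
    have "d x y < 1 / real (Suc N) \<longleftrightarrow> N < L x y"
      using False by (simp add: d_def field_simps)
    also have "\<dots> \<longleftrightarrow> (\<forall>n\<le>N. x \<in> B n \<longleftrightarrow> y \<in> B n)"
      using less_Least_iff[OF separating[OF that False], of N] by (simp add: L_def)
    finally show ?thesis .
  qed (simp add: d_def)
  have ultra: "d x z \<le> max (d x y) (d y z)" if "x \<in> ?M" "y \<in> ?M" "z \<in> ?M" for x y z
  \<comment> \<open>Agreement on an initial segment of indices is transitive. If
    \<open>d x z\<close> exceeded both other distances, \<open>x\<close> and \<open>z\<close> would
    agree, through \<open>y\<close>, even at their first separating index
    \<open>L x z\<close>.\<close>
  proof (rule ccontr)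
    assume less: "\<not> ?thesis"
    then have "x \<noteq> z" by (auto simp: d_def max_def split: if_splits)
    then have xz: "d x z = 1 / real (Suc (L x z))" by (simp add: d_def)
    with less have "d x y < 1 / real (Suc (L x z))" "d y z < 1 / real (Suc (L x z))" by auto
    then have "d x z < 1 / real (Suc (L x z))"
      using that by (simp only: d_less) blast
    with xz show False by simp
  qed
  interpret Metric_space ?M d
  proof
    show "0 \<le> d x y" for x y by (simp add: d_def)
    then show "d x z \<le> d x y + d y z" if "x \<in> ?M" "y \<in> ?M" "z \<in> ?M" for x y z
      using ultra[OF that] by (smt (verit))
    show "d x y = d y x" for x y by (simp add: d_def L_commute)
    show "d x y = 0 \<longleftrightarrow> x = y" for x y by (simp add: d_def)
  qed
  have mball: "mball x (1 / real (Suc N)) = {y \<in> ?M. \<forall>n\<le>N. x \<in> B n \<longleftrightarrow> y \<in> B n}"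
    if "x \<in> ?M" for x N
    using that d_less by auto
  have "openin X U \<longleftrightarrow> openin mtopology U" for U
  proof
    assume U: "openin X U"
    show "openin mtopology U"
      unfolding openin_mtopology
    proof (intro conjI allI impI)
      show "U \<subseteq> ?M" using U by (rule openin_subset)
      fix x assume "x \<in> U"
      with \<open>U \<subseteq> ?M\<close> have "x \<in> ?M" by blast
      obtain N where "mball x (1 / real (Suc N)) \<subseteq> U"
        using generating[OF U \<open>x \<in> U\<close>] unfolding mball[OF \<open>x \<in> ?M\<close>, symmetric] by blast
      then show "\<exists>r>0. mball x r \<subseteq> U"
        by (intro exI[of _ "1 / real (Suc N)"]) simp
    qed
  next
    assume U: "openin mtopology U"
    show "openin X U"
    proof (subst openin_subopen, intro ballI)
      fix x assume "x \<in> U"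
      with U obtain r where r: "r > 0" "mball x r \<subseteq> U" and x: "x \<in> ?M"
        unfolding openin_mtopology by blast
      obtain N where N: "1 / real (Suc N) < r"
        using nat_approx_posE[OF r(1)] by auto
      \<comment> \<open>A ball is a finite intersection of sets \<open>B n\<close> and complements
        of such sets; closedness of \<open>B n\<close> makes the complements open.\<close>
      have "mball x (1 / real (Suc N)) = (\<Inter>n\<le>N. if x \<in> B n then B n else ?M - B n)"
      proof -
        have "B n \<subseteq> ?M" for n using openin_subset[OF clopen(1)] .
        then show ?thesis
          unfolding mball[OF x] set_eq_iff INT_iff mem_Collect_eq
          by (smt (verit) DiffD1 DiffD2 DiffI atMost_iff subsetD zero_le)
      qed
      moreover have "openin X \<dots>"
        using clopen by (intro openin_Inter) auto
      moreover have "mball x (1 / real (Suc N)) \<subseteq> U"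
        using mball_subset_concentric[of "1 / real (Suc N)" r x] N r(2) by simp
      moreover have "x \<in> mball x (1 / real (Suc N))"
        using x by simp
      ultimately show "\<exists>T. openin X T \<and> x \<in> T \<and> T \<subseteq> U"
        by metis
    qed
  qed
  then have "X = mtopology" by (simp add: topology_eq)
  then show ?thesis
    using ultra Metric_space_axioms unfolding ultrametrizable_space_def by blast
qed

section \<open>Basic properties of the upper limit topology\<close>

lemma topspace_upper_limit_topology [simp]:
  "topspace (upper_limit_topology a b \<Lambda>) = {a<..b}"
  unfolding upper_limit_topology_def topology_generated_by_topspace by blast

text \<open>The generators have their left end inside \<open>{a<..b}\<close>, which excludes
  \<open>a\<close>. An interval starting at \<open>c = a\<close> is still open, being a union of
  generators that start strictly to the right of \<open>c\<close>.\<close>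

lemma openin_upper_limit_topology_interval:
  assumes "a \<le> c" "l \<in> insert \<infinity> (ereal ` \<Lambda>)"
  shows "openin (upper_limit_topology a b \<Lambda>) ({c<..l} \<inter> {a<..b})"
proof (subst openin_subopen, intro ballI)
  fix x assume x: "x \<in> {c<..l} \<inter> {a<..b}"
  then obtain \<alpha> where \<alpha>: "c < \<alpha>" "\<alpha> < x" using dense[of c x] by auto
  have "\<alpha> \<in> {a<..b}" using \<alpha> x assms(1) by auto
  with assms(2) have "openin (upper_limit_topology a b \<Lambda>) ({\<alpha><..l} \<inter> {a<..b})"
    unfolding upper_limit_topology_def
    by (intro topology_generated_by_Basis[OF insertI2] CollectI exI conjI) (rule refl)
  with \<alpha> x show "\<exists>T. openin (upper_limit_topology a b \<Lambda>) T \<and> x \<in> T \<and> T \<subseteq> {c<..l} \<inter> {a<..b}"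
    by (intro exI[of _ "{\<alpha><..l} \<inter> {a<..b}"]) auto
qed

text \<open>Intersecting two such intervals takes the maximum of the left ends and the minimum of
  the right ends, so finite intersections give nothing new. The whole space is covered by
  \<open>c = a\<close> and \<open>l = \<infinity>\<close>.\<close>

lemma upper_limit_topology_local_base:
  assumes "openin (upper_limit_topology a b \<Lambda>) U" "x \<in> U"
  shows "\<exists>c l. a \<le> c \<and> c < x \<and> x \<le> l \<and> l \<in> insert \<infinity> (ereal ` \<Lambda>) \<and> {c<..l} \<inter> {a<..b} \<subseteq> U"
proof -
  have "generate_topology_on
    (insert {a<..b} {{\<alpha><..l} \<inter> {a<..b} | \<alpha> l. \<alpha> \<in> {a<..b} \<and> l \<in> insert \<infinity> (ereal ` \<Lambda>)}) U"
    using assms(1) by (simp add: upper_limit_topology_def openin_topology_generated_by_iff)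
  then show ?thesis
    using assms(2)
  proof induction
    case Empty
    then show ?case by simp
  next
    case (Int U V)
    obtain c l where c: "a \<le> c" "c < x" "x \<le> l" "l \<in> insert \<infinity> (ereal ` \<Lambda>)" "{c<..l} \<inter> {a<..b} \<subseteq> U"
      using Int.IH(1) Int.prems by blast
    obtain c' l' where c': "a \<le> c'" "c' < x" "x \<le> l'" "l' \<in> insert \<infinity> (ereal ` \<Lambda>)" "{c'<..l'} \<inter> {a<..b} \<subseteq> V"
      using Int.IH(2) Int.prems by blast
    show ?case
    proof (intro exI conjI)
      show "a \<le> max c c'" "max c c' < x" "x \<le> min l l'"
        using c(1-3) c'(1-3) by (auto simp: le_max_iff_disj)
      show "min l l' \<in> insert \<infinity> (ereal ` \<Lambda>)" using c(4) c'(4) by (simp only: min_def split: if_split) blast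
      show "{max c c'<..min l l'} \<inter> {a<..b} \<subseteq> U \<inter> V" using c(5) c'(5) by auto
    qed
  next
    case (UN K)
    then obtain V where "V \<in> K" "x \<in> V" by blast
    then show ?case using UN.IH[of V] by (meson Union_upper order_trans)
  next
    case (Basis s)
    then consider "s = {a<..b}"
      | \<alpha> l where "s = {\<alpha><..l} \<inter> {a<..b}" "\<alpha> \<in> {a<..b}" "l \<in> insert \<infinity> (ereal ` \<Lambda>)"
      by blast
    then show ?case
    proof cases
      case 1
      with Basis show ?thesis by (intro exI[of _ a] exI[of _ \<infinity>]) auto
    next
      case 2
      with Basis show ?thesis by (intro exI[of _ \<alpha>] exI[of _ l]) auto
    qed
  qed
qed

lemma separable_space_upper_limit_topology:
  "separable_space (upper_limit_topology a b \<Lambda>)"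
proof -
  let ?D = "range (\<lambda>q. ereal (real_of_rat q)) \<inter> {a<..b}"
  have "x \<in> (upper_limit_topology a b \<Lambda>) closure_of ?D" if "x \<in> {a<..b}" for x
    unfolding in_closure_of
  proof (intro conjI allI impI)
    fix U assume "x \<in> U \<and> openin (upper_limit_topology a b \<Lambda>) U"
    then obtain c l where c: "a \<le> c" "c < x" "x \<le> l" "{c<..l} \<inter> {a<..b} \<subseteq> U"
      using upper_limit_topology_local_base by metis
    \<comment> \<open>Every basic neighbourhood of \<open>x\<close> extends to the left of
      \<open>x\<close>, so a rational just below \<open>x\<close> satisfies the bounds
      \<open>l\<close> and \<open>b\<close> automatically.\<close>
    obtain q where q: "c < ereal (real_of_rat q)" "ereal (real_of_rat q) < x"
      using ereal_dense3[OF c(2)] by auto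
    have "ereal (real_of_rat q) \<in> {c<..l} \<inter> {a<..b}"
      using q c that by auto
    then show "\<exists>y. y \<in> ?D \<and> y \<in> U"
      using c(4) by blast
  qed (use that in simp)
  then have "(upper_limit_topology a b \<Lambda>) closure_of ?D = {a<..b}"
    by (intro equalityI) (auto simp: in_closure_of)
  moreover have "countable ?D"
    by (intro countable_Int1 countable_image) simp
  ultimately show ?thesis
    unfolding separable_space_def by (intro exI[of _ ?D]) auto
qed

lemma second_countable_upper_limit_topology_imp_countable:
  assumes "ereal ` \<Lambda> \<subseteq> {a<..b}" "second_countable (upper_limit_topology a b \<Lambda>)"
  shows "countable \<Lambda>"
proof -
  let ?X = "upper_limit_topology a b \<Lambda>"
  obtain \<B> where "countable \<B>"
    and \<B>: "\<And>U x. \<lbrakk>openin ?X U; x \<in> U\<rbrakk> \<Longrightarrow> \<exists>V\<in>\<B>. x \<in> V \<and> V \<subseteq> U"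
    using assms(2) unfolding second_countable_def by metis
  have "\<exists>V\<in>\<B>. ereal x \<in> V \<and> V \<subseteq> {a<..ereal x}" if "x \<in> \<Lambda>" for x
  proof -
    have "openin ?X ({a<..ereal x} \<inter> {a<..b})"
      using that by (intro openin_upper_limit_topology_interval) auto
    moreover have "ereal x \<in> {a<..ereal x} \<inter> {a<..b}"
      using that assms(1) by auto
    ultimately obtain V where "V \<in> \<B>" "ereal x \<in> V" "V \<subseteq> {a<..ereal x} \<inter> {a<..b}"
      using \<B>[of "{a<..ereal x} \<inter> {a<..b}" "ereal x"] by metis
    then show ?thesis by (intro bexI[of _ V]) auto
  qed
  then obtain V where V: "\<And>x. x \<in> \<Lambda> \<Longrightarrow> V x \<in> \<B> \<and> ereal x \<in> V x \<and> V x \<subseteq> {a<..ereal x}"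
    by metis
  have "inj_on V \<Lambda>"
  proof (rule inj_onI)
    fix x y assume "x \<in> \<Lambda>" "y \<in> \<Lambda>" "V x = V y"
    \<comment> \<open>The common set contains both points and has each of them as an upper
      bound.\<close>
    then have "ereal x \<in> {a<..ereal y}" "ereal y \<in> {a<..ereal x}"
      using V by blast+
    then show "x = y" by simp
  qed
  moreover have "countable (V ` \<Lambda>)"
    using V by (intro countable_subset[OF _ \<open>countable \<B>\<close>]) auto
  ultimately show ?thesis
    by (rule countable_image_inj_on[rotated])
qed

section \<open>Density and the ultrametric for countable \<Lambda>\<close>

lemma dense_in_interval_between:
  fixes a b :: ereal
  assumes "(top_of_set {a<..b}) closure_of L = {a<..b}" "a \<le> x" "x < y" "y \<le> b"
  shows "\<exists>l\<in>L. x < l \<and> l < y"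
proof -
  \<comment> \<open>Neither end need serve as a point of closure (\<open>x\<close> may be
    \<open>a\<close>), so density is applied at an intermediate \<open>z\<close>.\<close>
  obtain z where z: "x < z" "z < y" using dense[OF assms(3)] by auto
  then have "z \<in> (top_of_set {a<..b}) closure_of L"
    using assms by auto
  moreover have "openin (top_of_set {a<..b}) ({a<..b} \<inter> {x<..<y})"
    by (intro openin_open_Int) simp
  moreover have "z \<in> {a<..b} \<inter> {x<..<y}"
    using z assms(2,4) by auto
  ultimately obtain l where "l \<in> L" "l \<in> {a<..b} \<inter> {x<..<y}"
    unfolding in_closure_of by blast
  then show ?thesis by auto
qed

lemma countable_imp_ultrametrizable_upper_limit_topology:
  assumes "a < b" "ereal ` \<Lambda> \<subseteq> {a<..b}"
    and dense: "(top_of_set {a<..b}) closure_of (ereal ` \<Lambda>) = {a<..b}"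
    and "countable \<Lambda>"
  shows "ultrametrizable_space (upper_limit_topology a b \<Lambda>)"
proof -
  let ?X = "upper_limit_topology a b \<Lambda>"
  have between: "\<exists>l\<in>\<Lambda>. x < ereal l \<and> ereal l < y" if "a \<le> x" "x < y" "y \<le> b" for x y
    using dense_in_interval_between[OF dense that] by blast
  then have "\<Lambda> \<noteq> {}" using \<open>a < b\<close> by blast
  then have range: "range (from_nat_into \<Lambda>) = \<Lambda>"
    using \<open>countable \<Lambda>\<close> by (rule range_from_nat_into)
  define e where "e = from_nat_into \<Lambda>"
  define B where "B n = {a<..ereal (e n)}" for n
  have e: "e n \<in> \<Lambda>" "ereal (e n) \<in> {a<..b}" for n
    using range assms(2) unfolding e_def by blast+
  have e_surj: "\<exists>n. e n = l" if "l \<in> \<Lambda>" for l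
    using range that by (metis e_def imageE)
  show ?thesis
  proof (rule ultrametrizable_space_clopen_sequence)
    fix n
    have B: "B n = {a<..ereal (e n)} \<inter> {a<..b}" "{a<..b} - B n = {ereal (e n)<..\<infinity>} \<inter> {a<..b}"
      using e(2)[of n] by (auto simp: B_def)
    show openin_B: "openin ?X (B n)"
      unfolding B(1) using e by (intro openin_upper_limit_topology_interval) auto
    have "openin ?X ({a<..b} - B n)"
      unfolding B(2) using e(2)[of n] by (intro openin_upper_limit_topology_interval) auto
    then show "closedin ?X (B n)"
      using openin_B[THEN openin_subset] by (simp add: closedin_def)
  next
    fix x y assume "x \<in> topspace ?X" "y \<in> topspace ?X" "x \<noteq> y"
    then show "\<exists>n. (x \<in> B n) \<noteq> (y \<in> B n)"
    proof (induction x y rule: linorder_wlog)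
      case (le x y)
      then obtain l where "l \<in> \<Lambda>" "x < ereal l" "ereal l < y"
        using between[of x y] by fastforce
      with e_surj obtain n where "x < ereal (e n)" "ereal (e n) < y" by metis
      with le show ?case by (intro exI[of _ n]) (auto simp: B_def)
    next
      case (sym x y)
      then show ?case by metis
    qed
  next
    fix U x assume U: "openin ?X U" "x \<in> U"
    then have x: "x \<in> {a<..b}" using openin_subset by fastforce
    obtain c l where c: "a \<le> c" "c < x" "x \<le> l" "l \<in> insert \<infinity> (ereal ` \<Lambda>)" "{c<..l} \<inter> {a<..b} \<subseteq> U"
      using upper_limit_topology_local_base[OF U] by blast
    \<comment> \<open>The index \<open>m\<close> controls the left end: \<open>x\<close> lies
      outside \<open>B m\<close>, so any \<open>y\<close> agreeing with \<open>x\<close> there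
      exceeds \<open>e m\<close>, hence \<open>c\<close>. The index \<open>k\<close> below controls
      the right end, since \<open>x\<close> lies in \<open>B k\<close>; for
      \<open>l = \<infinity>\<close> it is arbitrary.\<close>
    obtain m where m: "c < ereal (e m)" "ereal (e m) < x"
      using between[OF c(1,2)] x e_surj by (metis greaterThanAtMost_iff)
    obtain k where k: "l = \<infinity> \<or> l = ereal (e k)"
      using c(4) e_surj by blast
    have "y \<in> U" if "y \<in> {a<..b}" and eq: "\<And>n. n \<le> max m k \<Longrightarrow> x \<in> B n \<longleftrightarrow> y \<in> B n" for y
    proof -
      have "c < y"
        using eq[of m] m x \<open>y \<in> _\<close> by (auto simp: B_def)
      moreover have "y \<le> l"
        using eq[of k] k x c(3) by (auto simp: B_def)
      ultimately show ?thesis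
        using c(5) \<open>y \<in> _\<close> by auto
    qed
    then show "\<exists>N. {y \<in> topspace ?X. \<forall>n\<le>N. x \<in> B n \<longleftrightarrow> y \<in> B n} \<subseteq> U"
      by (intro exI[of _ "max m k"]) auto
  qed
qed

theorem proposition4p7:
  fixes a b :: ereal and \<Lambda> :: "real set"
  assumes "a < b"
    and "ereal ` \<Lambda> \<subseteq> {a<..b}"
    and "(top_of_set {a<..b}) closure_of (ereal ` \<Lambda>) = {a<..b}"
  shows "(countable \<Lambda> \<longleftrightarrow> second_countable (upper_limit_topology a b \<Lambda>)) \<and>
         (second_countable (upper_limit_topology a b \<Lambda>) \<longleftrightarrow>
            metrizable_space (upper_limit_topology a b \<Lambda>)) \<and>
         (metrizable_space (upper_limit_topology a b \<Lambda>) \<longleftrightarrow>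
            ultrametrizable_space (upper_limit_topology a b \<Lambda>))"
proof -
  let ?X = "upper_limit_topology a b \<Lambda>"
  have "countable \<Lambda> \<Longrightarrow> ultrametrizable_space ?X"
    using assms by (rule countable_imp_ultrametrizable_upper_limit_topology)
  moreover have "ultrametrizable_space ?X \<Longrightarrow> metrizable_space ?X"
    by (rule ultrametrizable_imp_metrizable_space)
  moreover have "metrizable_space ?X \<Longrightarrow> second_countable ?X"
    using separable_space_upper_limit_topology
    by (rule metrizable_separable_imp_second_countable[rotated])
  moreover have "second_countable ?X \<Longrightarrow> countable \<Lambda>"
    using assms(2) by (rule second_countable_upper_limit_topology_imp_countable)
  ultimately show ?thesis by argo
qed

end
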